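(* Let $m \geq 1$ and $k \geq 2$ be integers, let $G$ be a chordal graph, and let $w$ and $w'$ be $m$-weightings of $G$ such that $w'$ is uniform-$\alpha$. Then $\pi_k(G(w')) \leq \pi_k(G(w))$.
   Context: All graphs are simple. $\mathbb{N}_0 = \{0,1,2,\dots\}$, $[n]=\{1,\dots,n\}$. For a graph $G$, a function $w: V(G) \to \mathbb{N}_0$ with $\sum_{v \in V(G)} w(v) = m$ is an $m$-weighting of $G$. $G(w)$ is the graph obtained from $G$ by replacing each vertex $v$ by a clique $K^v$ on $w(v)$ vertices and joining every vertex of $K^u$ to every vertex of $K^v$ whenever $uv \in E(G)$. $\pi_k(H)$ denotes the number of $k$-cliques of a graph $H$. For $U \subseteq V(G)$, an $m$-weighting $w$ is uniform on $U$ if $w(v)=0$ for all $v \notin U$ and $w(u) \in \{\lfloor m/|U|\rfloor, \lceil m/|U| \rceil\}$ for all $u \in U$; $w$ is uniform-$\alpha$ if it is uniform on some independent set of $G$ of maximum size. A graph $G$ with $n$ vertices is chordal if there is an ordering $v_1,\dots,v_n$ of $V(G)$ such that for each $i \in [n]$ the set $N_G[v_i] \setminus \{v_1,\dots,v_{i-1}\}$ is the vertex set of a clique of $G$, where $N_G[v]$ is $v$ together with its neighbours. *)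

theory Defs imports Complex_Main begin

type_synonym 'a graph = "'a set \<times> 'a set set"

abbreviation verts :: "'a graph \<Rightarrow> 'a set" where "verts \<equiv> fst"
abbreviation edges :: "'a graph \<Rightarrow> 'a set set" where "edges \<equiv> snd"

definition simple_graph :: "'a graph \<Rightarrow> bool" where
  "simple_graph G \<longleftrightarrow>
     finite (verts G) \<and> (\<forall>e \<in> edges G. e \<subseteq> verts G \<and> card e = 2)"

definition is_clique :: "'a graph \<Rightarrow> 'a set \<Rightarrow> bool" where
  "is_clique G C \<longleftrightarrow>
     C \<subseteq> verts G \<and> (\<forall>u \<in> C. \<forall>v \<in> C. u \<noteq> v \<longrightarrow> {u, v} \<in> edges G)"

definition num_cliques :: "nat \<Rightarrow> 'a graph \<Rightarrow> nat" where
  "num_cliques k G = card {C. is_clique G C \<and> card C = k}"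

definition independent :: "'a graph \<Rightarrow> 'a set \<Rightarrow> bool" where
  "independent G U \<longleftrightarrow> U \<subseteq> verts G \<and> (\<forall>u \<in> U. \<forall>v \<in> U. {u, v} \<notin> edges G)"

definition maximum_independent :: "'a graph \<Rightarrow> 'a set \<Rightarrow> bool" where
  "maximum_independent G U \<longleftrightarrow>
     independent G U \<and> (\<forall>W. independent G W \<longrightarrow> card W \<le> card U)"

definition closed_nbhd :: "'a graph \<Rightarrow> 'a \<Rightarrow> 'a set" where
  "closed_nbhd G v = insert v {u. {v, u} \<in> edges G}"

definition chordal :: "'a graph \<Rightarrow> bool" where
  "chordal G \<longleftrightarrow>
     (\<exists>vs. distinct vs \<and> set vs = verts G \<and>
       (\<forall>i < length vs. is_clique G (closed_nbhd G (vs ! i) - set (take i vs))))"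

text \<open>Only the values of a weighting on the vertex set are relevant; its values
  elsewhere are unconstrained.\<close>

definition weighting :: "nat \<Rightarrow> 'a graph \<Rightarrow> ('a \<Rightarrow> nat) \<Rightarrow> bool" where
  "weighting m G w \<longleftrightarrow> (\<Sum>v \<in> verts G. w v) = m"

text \<open>The graph $G(w)$: the clique $K^v$ has vertex set $\{v\} \times \{0,\dots,w(v)-1\}$.\<close>

definition blowup :: "'a graph \<Rightarrow> ('a \<Rightarrow> nat) \<Rightarrow> ('a \<times> nat) graph" where
  "blowup G w =
     (let V = (SIGMA v : verts G. {..<w v}) in
      (V, {{x, y} | x y. x \<in> V \<and> y \<in> V \<and> x \<noteq> y \<and>
                         (fst x = fst y \<or> {fst x, fst y} \<in> edges G)}))"

definition uniform_on :: "nat \<Rightarrow> 'a graph \<Rightarrow> 'a set \<Rightarrow> ('a \<Rightarrow> nat) \<Rightarrow> bool" where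
  "uniform_on m G U w \<longleftrightarrow>
     weighting m G w \<and> U \<subseteq> verts G \<and> (\<forall>v \<in> verts G - U. w v = 0) \<and>
     (\<forall>u \<in> U. int (w u) \<in> {\<lfloor>real m / real (card U)\<rfloor>, \<lceil>real m / real (card U)\<rceil>})"

definition uniform_alpha :: "nat \<Rightarrow> 'a graph \<Rightarrow> ('a \<Rightarrow> nat) \<Rightarrow> bool" where
  "uniform_alpha m G w \<longleftrightarrow> (\<exists>U. maximum_independent G U \<and> uniform_on m G U w)"

lemma simple_graph_blowup:
  assumes "simple_graph G"
  shows "simple_graph (blowup G w)"
  using assms unfolding simple_graph_def blowup_def Let_def
  by (auto simp: card_insert_if)

end

theory Submission imports Defs begin

text \<open>A chordal graph is perfect: picking vertices greedily along a perfect elimination ordering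
  yields an independent set \<open>S\<close> and a partition of the vertices into \<open>card S\<close> cliques, where
  \<open>card S \<le> \<alpha>\<close>. Blowing up these cliques partitions \<open>G(w)\<close> into at most \<open>\<alpha>\<close> cliques, and
  counting only the \<open>k\<close>-cliques inside the parts gives a sum of binomial coefficients. By convexity
  this sum is smallest when there are exactly \<open>\<alpha>\<close> parts of almost equal size, and this value is
  the number of \<open>k\<close>-cliques of \<open>G(w')\<close>, since \<open>w'\<close> lives on an independent set.\<close>

lemma is_clique_subset: "is_clique G C \<Longrightarrow> D \<subseteq> C \<Longrightarrow> is_clique G D"
  unfolding is_clique_def by blast

text \<open>Induction along the ordering: if its first vertex \<open>v\<close> lies in
  \<open>X\<close>, then \<open>v\<close> joins \<open>S\<close>, the part of \<open>X\<close> in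
  its closed neighbourhood becomes the fibre over \<open>v\<close>, and the rest of \<open>X\<close>
  is left to the tail. Keeping \<open>X\<close> arbitrary permits these deletions; phrasing the
  hypothesis with \<open>drop\<close> lets it pass to the tail by an index shift.\<close>

lemma elimination_ordering_clique_partition:
  assumes "simple_graph G" and "X \<subseteq> set vs" and "set vs \<subseteq> verts G"
    and "\<And>i. i < length vs \<Longrightarrow> is_clique G (closed_nbhd G (vs ! i) \<inter> set (drop i vs))"
  shows "\<exists>S c. independent G S \<and> S \<subseteq> X \<and> c ` X \<subseteq> S \<and> (\<forall>s\<in>S. is_clique G {x\<in>X. c x = s})"
  using assms(2-)
proof (induction vs arbitrary: X)
  case Nil
  then show ?case by (auto simp: independent_def)
next
  case (Cons v vs)
  have peo: "is_clique G (closed_nbhd G (vs ! i) \<inter> set (drop i vs))" if "i < length vs" for i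
    using Cons.prems(3)[of "Suc i"] that by simp
  have clique: "is_clique G (closed_nbhd G v \<inter> set (v # vs))"
    using Cons.prems(3)[of 0] by simp
  show ?case
  proof (cases "v \<in> X")
    case False
    then show ?thesis using Cons.IH[of X] Cons.prems peo by auto
  next
    case True
    define Y where "Y = X - closed_nbhd G v"
    have "Y \<subseteq> set vs" using Cons.prems(1) by (auto simp: Y_def closed_nbhd_def)
    then obtain S c where S: "independent G S" "S \<subseteq> Y" "c ` Y \<subseteq> S"
      and fibres: "\<And>s. s \<in> S \<Longrightarrow> is_clique G {x\<in>Y. c x = s}"
      using Cons.IH[of Y] Cons.prems(2) peo by auto
    define d where "d x = (if x \<in> closed_nbhd G v then v else c x)" for x
    have "v \<notin> S" using S(2) by (auto simp: Y_def closed_nbhd_def)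
    \<comment> \<open>The definition of \<open>independent\<close> also tests a vertex against
      itself, so loops must be excluded.\<close>
    have "{v, v} \<notin> edges G" using assms(1) by (fastforce simp: simple_graph_def)
    moreover have "{v, s} \<notin> edges G \<and> {s, v} \<notin> edges G" if "s \<in> S" for s
      using S(2) that by (auto simp: Y_def closed_nbhd_def insert_commute)
    ultimately have "independent G (insert v S)"
      using S(1) Cons.prems(2) by (auto simp: independent_def)
    moreover have "insert v S \<subseteq> X" using S(2) True by (auto simp: Y_def)
    moreover have "d ` X \<subseteq> insert v S" using S(3) by (auto simp: d_def Y_def)
    moreover have "is_clique G {x\<in>X. d x = s}" if "s \<in> insert v S" for s
    proof (cases "s = v")
      case True
      \<comment> \<open>No vertex of \<open>Y\<close> enters this fibre, because \<open>c\<close>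
        maps \<open>Y\<close> into \<open>S\<close> and \<open>v\<close> is not in
        \<open>S\<close>.\<close>
      have "{x\<in>X. d x = v} \<subseteq> closed_nbhd G v \<inter> set (v # vs)"
        using S(3) Cons.prems(1) \<open>v \<notin> S\<close> by (auto simp: d_def Y_def)
      then show ?thesis using clique is_clique_subset True by blast
    next
      case False
      then have "{x\<in>X. d x = s} \<subseteq> {x\<in>Y. c x = s}" by (auto simp: d_def Y_def)
      then show ?thesis using fibres[of s] that False is_clique_subset by blast
    qed
    ultimately show ?thesis by blast
  qed
qed

lemma chordal_clique_partition:
  assumes "simple_graph G" and "chordal G"
  obtains S c where "independent G S" "c ` verts G \<subseteq> S"
    "\<And>s. s \<in> S \<Longrightarrow> is_clique G {v \<in> verts G. c v = s}"
proof -
  obtain vs where vs: "distinct vs" "set vs = verts G"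
    "\<And>i. i < length vs \<Longrightarrow> is_clique G (closed_nbhd G (vs ! i) - set (take i vs))"
    using assms(2) unfolding chordal_def by blast
  have "is_clique G (closed_nbhd G (vs ! i) \<inter> set (drop i vs))" if "i < length vs" for i
  proof -
    have "set (take i vs) \<inter> set (drop i vs) = {}"
      using vs(1) by (simp add: set_take_disj_set_drop_if_distinct)
    then show ?thesis using is_clique_subset[OF vs(3)[OF that]] by blast
  qed
  then show ?thesis
    using elimination_ordering_clique_partition[OF assms(1), of "verts G" vs] vs(2) that by auto
qed

lemma verts_blowup: "verts (blowup G w) = (SIGMA v : verts G. {..<w v})"
  by (simp add: blowup_def Let_def)

lemma edge_blowup_iff:
  "{x, y} \<in> edges (blowup G w) \<longleftrightarrow> x \<in> verts (blowup G w) \<and> y \<in> verts (blowup G w) \<and> x \<noteq> y \<and>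
     (fst x = fst y \<or> {fst x, fst y} \<in> edges G)"
proof
  assume "{x, y} \<in> edges (blowup G w)"
  then obtain a b where "{x, y} = {a, b}" "a \<in> verts (blowup G w)" "b \<in> verts (blowup G w)" "a \<noteq> b"
    "fst a = fst b \<or> {fst a, fst b} \<in> edges G"
    by (auto simp: blowup_def Let_def)
  moreover from this have "x = a \<and> y = b \<or> x = b \<and> y = a" by (simp add: doubleton_eq_iff)
  ultimately show "x \<in> verts (blowup G w) \<and> y \<in> verts (blowup G w) \<and> x \<noteq> y \<and>
      (fst x = fst y \<or> {fst x, fst y} \<in> edges G)"
    by (elim disjE conjE) (simp_all add: insert_commute)
qed (unfold blowup_def Let_def fst_conv snd_conv, blast)

text \<open>The blow-up \<open>P s\<close> of a clique fibre is itself a clique, so each of its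
  \<open>k\<close>-subsets counts. Distinct fibres have disjoint blow-ups, and \<open>k\<close>
  being positive rules out the empty set as a common subset, so nothing is counted twice.\<close>

lemma num_cliques_blowup_ge:
  assumes "simple_graph G" and "k \<ge> 1" and "finite S"
    and fibres: "\<And>s. s \<in> S \<Longrightarrow> is_clique G {v \<in> verts G. c v = s}"
  shows "(\<Sum>s\<in>S. (\<Sum>v | v \<in> verts G \<and> c v = s. w v) choose k) \<le> num_cliques k (blowup G w)"
proof -
  define P where "P s = (SIGMA v : {v \<in> verts G. c v = s}. {..<w v})" for s
  have fin: "finite (verts G)" using assms(1) by (simp add: simple_graph_def)
  have finP: "finite (P s)" for s using fin by (auto simp: P_def)
  have "finite (verts (blowup G w))"
    using simple_graph_blowup[OF assms(1)] by (simp add: simple_graph_def)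
  then have finC: "finite {C. is_clique (blowup G w) C \<and> card C = k}"
    by (rule finite_subset[rotated, OF finite_Pow_iff[THEN iffD2]]) (auto simp: is_clique_def)
  have "(\<Sum>s\<in>S. (\<Sum>v | v \<in> verts G \<and> c v = s. w v) choose k)
      = (\<Sum>s\<in>S. card {C. C \<subseteq> P s \<and> card C = k})"
    using fin finP by (simp add: n_subsets P_def card_SigmaI)
  also have "\<dots> = card (\<Union>s\<in>S. {C. C \<subseteq> P s \<and> card C = k})"
  proof (rule card_UN_disjoint[symmetric])
    show "\<forall>s\<in>S. finite {C. C \<subseteq> P s \<and> card C = k}" using finP by simp
    show "\<forall>s\<in>S. \<forall>t\<in>S. s \<noteq> t \<longrightarrow>
        {C. C \<subseteq> P s \<and> card C = k} \<inter> {C. C \<subseteq> P t \<and> card C = k} = {}"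
    proof (intro ballI impI equals0I)
      fix s t C
      assume "s \<noteq> t" and C: "C \<in> {C. C \<subseteq> P s \<and> card C = k} \<inter> {C. C \<subseteq> P t \<and> card C = k}"
      have "P s \<inter> P t = {}" using \<open>s \<noteq> t\<close> by (auto simp: P_def)
      then have "C = {}" using C by blast
      then show False using C assms(2) by simp
    qed
  qed (fact assms(3))
  also have "\<dots> \<le> card {C. is_clique (blowup G w) C \<and> card C = k}"
  proof (rule card_mono[OF finC], safe)
    fix s C assume "s \<in> S" "C \<subseteq> P s"
    have "is_clique (blowup G w) (P s)"
      using fibres[OF \<open>s \<in> S\<close>]
      by (auto simp: is_clique_def edge_blowup_iff verts_blowup P_def)
    then show "is_clique (blowup G w) C" using \<open>C \<subseteq> P s\<close> is_clique_subset by blast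
  qed
  finally show ?thesis by (simp add: num_cliques_def)
qed

text \<open>Only the vertices of \<open>U\<close> have nonempty columns, and no edge joins two
  different columns over an independent set. A nonempty clique therefore stays inside one
  column.\<close>

lemma num_cliques_blowup_independent_le:
  assumes "simple_graph G" and "k \<ge> 1" and "independent G U"
    and "\<And>v. v \<in> verts G - U \<Longrightarrow> w v = 0"
  shows "num_cliques k (blowup G w) \<le> (\<Sum>u\<in>U. w u choose k)"
proof -
  have finU: "finite U"
    using assms(1,3) by (auto simp: simple_graph_def independent_def intro: finite_subset)
  have "{C. is_clique (blowup G w) C \<and> card C = k}
      \<subseteq> (\<Union>u\<in>U. {C. C \<subseteq> {u} \<times> {..<w u} \<and> card C = k})"
  proof safe
    fix C assume C: "is_clique (blowup G w) C" and k: "k = card C"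
    have "C \<noteq> {}" using k assms(2) by auto
    then obtain x where x: "x \<in> C" by blast
    have inU: "fst y \<in> U \<and> snd y < w (fst y)" if "y \<in> C" for y
      using C that assms(4)[of "fst y"] by (force simp: is_clique_def verts_blowup)
    have "fst y = fst x" if "y \<in> C" for y
      using C that x inU assms(3) by (auto simp: is_clique_def edge_blowup_iff independent_def)
    then have "C \<subseteq> {fst x} \<times> {..<w (fst x)}"
      using inU by (force simp: mem_Times_iff)
    then show "C \<in> (\<Union>u\<in>U. {D. D \<subseteq> {u} \<times> {..<w u} \<and> card D = card C})"
      using inU[OF x] by blast
  qed
  then have "num_cliques k (blowup G w) \<le> card (\<Union>u\<in>U. {C. C \<subseteq> {u} \<times> {..<w u} \<and> card C = k})"
    unfolding num_cliques_def using finU by (intro card_mono) auto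
  also have "\<dots> \<le> (\<Sum>u\<in>U. card {C. C \<subseteq> {u} \<times> {..<w u} \<and> card C = k})"
    using finU by (rule card_UN_le)
  also have "\<dots> = (\<Sum>u\<in>U. w u choose k)"
    by (simp add: n_subsets card_cartesian_product)
  finally show ?thesis .
qed

text \<open>Discrete convexity: the increment of \<open>n choose Suc j\<close> at \<open>n\<close>
  is \<open>n choose j\<close>, which is nondecreasing in \<open>n\<close>, so the line through the
  point at \<open>q\<close> with slope \<open>q choose j\<close> supports the function from
  below.\<close>

lemma binomial_ge_tangent:
  "int (n choose Suc j) \<ge> int (q choose Suc j) + (int n - int q) * int (q choose j)"
proof (cases "q \<le> n")
  case True
  then show ?thesis
  proof (induction n rule: dec_induct)
    case (step n)
    have "int (q choose j) \<le> int (n choose j)"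
      using step(1) by (simp add: binomial_right_mono)
    then show ?case using step by (simp add: algebra_simps)
  qed simp
next
  case False
  then have "n \<le> q" by simp
  then show ?thesis
  \<comment> \<open>Here the point of tangency moves while \<open>n\<close> stays fixed: passing
    from \<open>q\<close> to \<open>Suc q\<close> can only lower the value of the line at
    \<open>n\<close>, as the slope grows and \<open>n\<close> lies to the left.\<close>
  proof (induction q rule: dec_induct)
    case (step q)
    have "int (q choose j) \<le> int (Suc q choose j)"
      by (simp only: of_nat_le_iff binomial_right_mono)
    then have "(int (Suc q) - int n) * int (q choose j) \<le> (int (Suc q) - int n) * int (Suc q choose j)"
      using step(1) by (intro mult_left_mono) auto
    then show ?case using step by (simp add: algebra_simps)
  qed simp
qed

text \<open>The supporting line \<open>b + n * t\<close> at \<open>q\<close> meets the binomial at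
  both \<open>q\<close> and \<open>Suc q\<close>, so it is exact on the values of \<open>y\<close>
  and a lower bound on those of \<open>x\<close>. Its sum depends only on the number of terms and
  their total.\<close>

lemma sum_binomial_balanced_le:
  fixes x :: "'a \<Rightarrow> nat" and y :: "'b \<Rightarrow> nat"
  assumes "card S \<le> card U" and "k \<ge> 1"
    and "sum x S = sum y U"
    and "\<And>u. u \<in> U \<Longrightarrow> y u = q \<or> y u = Suc q"
  shows "(\<Sum>u\<in>U. y u choose k) \<le> (\<Sum>s\<in>S. x s choose k)"
proof -
  obtain j where k: "k = Suc j" using assms(2) by (cases k) auto
  define b where "b = int (q choose Suc j) - int q * int (q choose j)"
  define t where "t = int (q choose j)"
  \<comment> \<open>The intercept is the supporting line evaluated at 0, where the binomial
    vanishes.\<close>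
  have "b \<le> 0" using binomial_ge_tangent[of q j 0] by (simp add: b_def)
  have "int (y u choose k) = b + int (y u) * t" if "u \<in> U" for u
    using assms(4)[OF that] by (auto simp: k b_def t_def algebra_simps)
  then have "int (\<Sum>u\<in>U. y u choose k) = (\<Sum>u\<in>U. b + int (y u) * t)"
    by simp
  also have "\<dots> = int (card U) * b + int (sum y U) * t"
    by (simp add: sum.distrib sum_distrib_right)
  \<comment> \<open>The totals agree, and since \<open>b\<close> is nonpositive, having fewer terms
    can only increase the sum.\<close>
  also have "\<dots> \<le> int (card S) * b + int (sum x S) * t"
    using assms(1,3) \<open>b \<le> 0\<close> by (simp add: mult_right_mono_neg)
  also have "\<dots> = (\<Sum>s\<in>S. b + int (x s) * t)"
    by (simp add: sum.distrib sum_distrib_right)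
  also have "\<dots> \<le> (\<Sum>s\<in>S. int (x s choose k))"
  proof (rule sum_mono)
    fix s
    show "b + int (x s) * t \<le> int (x s choose k)"
      using binomial_ge_tangent[of q j "x s"] by (simp add: k b_def t_def algebra_simps)
  qed
  also have "\<dots> = int (\<Sum>s\<in>S. x s choose k)" by simp
  finally show ?thesis by (simp only: of_nat_le_iff)
qed

lemma uniform_on_values:
  assumes "uniform_on m G U w" and "u \<in> U"
  shows "w u = m div card U \<or> w u = Suc (m div card U)"
proof -
  have "\<lfloor>real m / real (card U)\<rfloor> = int (m div card U)"
    by (simp add: floor_divide_of_nat_eq)
  moreover have "\<lceil>r\<rceil> = \<lfloor>r\<rfloor> \<or> \<lceil>r\<rceil> = \<lfloor>r\<rfloor> + 1" for r :: real
    by (simp add: ceiling_altdef)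
  ultimately have "int (w u) = int (m div card U) \<or> int (w u) = int (m div card U) + 1"
    using assms unfolding uniform_on_def by (metis insert_iff singletonD)
  then show ?thesis by linarith
qed

theorem theorem7:
  fixes G :: "'a graph" and m k :: nat and w w' :: "'a \<Rightarrow> nat"
  assumes "m \<ge> 1" and "k \<ge> 2"
    and "simple_graph G" and "chordal G"
    and "weighting m G w" and "weighting m G w'"
    and "uniform_alpha m G w'"
  shows "num_cliques k (blowup G w') \<le> num_cliques k (blowup G w)"
proof -
  have k: "k \<ge> 1" using assms(2) by simp
  have fin: "finite (verts G)" using assms(3) by (simp add: simple_graph_def)
  obtain U where U: "maximum_independent G U" "uniform_on m G U w'"
    using assms(7) by (auto simp: uniform_alpha_def)
  have indU: "independent G U" using U(1) by (simp add: maximum_independent_def)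
  have off: "w' v = 0" if "v \<in> verts G - U" for v
    using U(2) that by (auto simp: uniform_on_def)
  obtain S c where S: "independent G S" "c ` verts G \<subseteq> S"
    and fibres: "\<And>s. s \<in> S \<Longrightarrow> is_clique G {v \<in> verts G. c v = s}"
    using chordal_clique_partition[OF assms(3,4)] by blast
  have finS: "finite S" using S(1) fin by (auto simp: independent_def intro: finite_subset)
  have "sum w' U = m"
  proof -
    have "sum w' U = sum w' (verts G)"
      using indU off fin by (intro sum.mono_neutral_left) (auto simp: independent_def)
    then show ?thesis using assms(6) by (simp add: weighting_def)
  qed
  \<comment> \<open>The fibres of \<open>c\<close> over \<open>S\<close> partition the vertex set,
    so their weights add up to \<open>m\<close>.\<close>
  moreover have "(\<Sum>s\<in>S. \<Sum>v | v \<in> verts G \<and> c v = s. w v) = m"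
    using sum.group[OF fin finS S(2), of w] assms(5) by (simp add: weighting_def)
  moreover have "card S \<le> card U" using U(1) S(1) by (simp add: maximum_independent_def)
  ultimately have "(\<Sum>u\<in>U. w' u choose k)
      \<le> (\<Sum>s\<in>S. (\<Sum>v | v \<in> verts G \<and> c v = s. w v) choose k)"
    \<comment> \<open>The two consecutive values are \<open>m div card U\<close> and its successor,
      covering both floor and ceiling.\<close>
    by (intro sum_binomial_balanced_le[OF _ k _ uniform_on_values[OF U(2)]]) auto
  then show ?thesis
    using num_cliques_blowup_independent_le[OF assms(3) k indU, of w'] off
      num_cliques_blowup_ge[OF assms(3) k finS, of c w] fibres by fastforce
qed

end
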